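(* Let $n\in\{1,2\}$ and $\gamma=\frac{n+3}{n+1}$. Consider, on a uniform orthogonal mesh in the Lagrangian coordinates $(t,s)$ with time step $\tau$ and space step $h^s$, the explicit difference scheme $$\hat\rho\,(\hat r_+^{\,n+1}-\hat r^{\,n+1})=\rho\,(r_+^{\,n+1}-r^{\,n+1}),\qquad \frac{\hat u-u}{\tau}=-\Big(\frac{\hat\rho}{\rho}\Big)^{\frac{2}{n+1}}r^n\,\frac{p-p_-}{h^s},$$ $$\frac{\hat p}{\hat\rho^{\,\frac{n+3}{n+1}}}=\frac{p}{\rho^{\,\frac{n+3}{n+1}}},\qquad \frac{\hat r-r}{\tau}=u .$$ Then: (a) The scheme is invariant under the one-parameter groups generated by $$X_0=\partial_s,\quad X_1=\partial_t,\quad X_2=t\partial_t+(n+1)s\partial_s+r\partial_r,\quad X_3=2t\partial_t+(n+3)s\partial_s-u\partial_u+2\rho\partial_\rho+r\partial_r,$$ $$X_4=s\partial_s+\rho\partial_\rho+p\partial_p,\qquad X_{*,\gamma}=t^2\partial_t+(r-tu)\partial_u-(n+1)t\rho\,\partial_\rho-(n+3)tp\,\partial_p+tr\,\partial_r .$$ (b) The scheme conserves the entropy along pathlines, i.e. $\hat p/\hat\rho^{\gamma}=p/\rho^{\gamma}$, and possesses conservation of mass: if $h^s=\rho\,\frac{r_+^{n+1}-r^{n+1}}{n+1}$ (hence also $h^s=\hat\rho\,\frac{\hat r_+^{n+1}-\hat r^{n+1}}{n+1}$), the first equation can be rewritten as $$\frac1\tau\Big(\frac1{\hat\rho}-\frac1\rho\Big)=\frac{R_+u_+-Ru}{h^s},\qquad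 R=\frac{\hat r^{\,n+1}-r^{\,n+1}}{(n+1)(\hat r-r)} .$$
   Context: The scheme approximates the gas dynamics equations $(1/\rho)_t=(r^nu)_s$, $u_t+r^np_s=0$, $(p/\rho^\gamma)_t=0$, $r_t=u$ of radially ($n=1$) and spherically ($n=2$) symmetric flows of a polytropic gas in mass Lagrangian coordinates. Time layers are $t=t_j$, $\hat t=t_{j+1}=t+\tau$, and mesh points $s_i$ with $s_{i+1}-s_i=h^s$. The variables $u,r$ are attached to nodes: $u=u_i^j$, $u_+=u_{i+1}^j$, $\hat u=u_i^{j+1}$, $\hat u_+=u_{i+1}^{j+1}$, and similarly for $r$; $R_+$ is $R$ with $r,\hat r$ replaced by $r_+,\hat r_+$. The variables $\rho,p>0$ are attached to cell midpoints: $p=p_{i+1/2}^j$, $p_-=p_{i-1/2}^j$, $\hat p=p_{i+1/2}^{j+1}$, and similarly for $\rho$. Also $r>0$. The scheme equations hold at all nodes (in particular $\hat r_+=r_++\tau u_+$). A generator acts simultaneously on all mesh variables: the coefficient for each stencil variable is obtained by evaluating at the node/midpoint and time layer of that variable (so $\tau$ and $h^s$ transform as differences of transformed coordinates); the scheme is invariant under a generator if its (local) one-parameter group maps the set of stencil values satisfying the scheme equations into itself. *)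

theory Defs
  imports "HOL-Analysis.Analysis"
begin

text \<open>Every mesh point carries its own Lagrangian coordinates \<open>(t, s)\<close>, so that a generator
  acts on it pointwise and the steps transform as differences of transformed coordinates.
  Nodes carry \<open>u, r\<close>; cell midpoints carry \<open>\<rho>, p\<close>.\<close>

record node =
  tN :: real
  sN :: real
  uN :: real
  rN :: real

record cell =
  tC :: real
  sC :: real
  rhoC :: real
  pC :: real

text \<open>Index shifts: \<open>node\<close> is \<open>(i, j)\<close>, \<open>cell\<close> is \<open>(i+1/2, j)\<close>, suffix \<open>p\<close> is \<open>i+1\<close> in place
  of \<open>i\<close>, suffix \<open>m\<close> is \<open>i-1/2\<close> in place of \<open>i+1/2\<close>, suffix \<open>h\<close> (hat) is the layer \<open>j+1\<close>.\<close>

record stencil =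
  nd :: node
  nd_p :: node
  nd_h :: node
  nd_hp :: node
  cl :: cell
  cl_m :: cell
  cl_h :: cell

definition tau :: "stencil \<Rightarrow> real" where
  "tau z = tN (nd_h z) - tN (nd z)"

definition hs :: "stencil \<Rightarrow> real" where
  "hs z = sN (nd_p z) - sN (nd z)"

text \<open>Uniform orthogonal mesh: the time layers are flat, the space coordinates do not depend on
  the layer, and adjacent midpoints are at distance \<open>hs\<close>, symmetrically about the node.\<close>

definition orthogonal_mesh :: "stencil \<Rightarrow> bool" where
  "orthogonal_mesh z \<longleftrightarrow>
     tau z > 0 \<and> hs z > 0 \<and>
     tN (nd_p z) = tN (nd z) \<and> tC (cl z) = tN (nd z) \<and> tC (cl_m z) = tN (nd z) \<and>
     tN (nd_hp z) = tN (nd_h z) \<and> tC (cl_h z) = tN (nd_h z) \<and>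
     sN (nd_h z) = sN (nd z) \<and> sN (nd_hp z) = sN (nd_p z) \<and> sC (cl_h z) = sC (cl z) \<and>
     sC (cl z) = sN (nd z) + hs z / 2 \<and> sC (cl_m z) = sN (nd z) - hs z / 2"

definition positive_state :: "stencil \<Rightarrow> bool" where
  "positive_state z \<longleftrightarrow>
     rN (nd z) > 0 \<and> rN (nd_p z) > 0 \<and> rN (nd_h z) > 0 \<and> rN (nd_hp z) > 0 \<and>
     rhoC (cl z) > 0 \<and> rhoC (cl_m z) > 0 \<and> rhoC (cl_h z) > 0 \<and>
     pC (cl z) > 0 \<and> pC (cl_m z) > 0 \<and> pC (cl_h z) > 0"

definition eq_mass :: "nat \<Rightarrow> stencil \<Rightarrow> bool" where
  "eq_mass n z \<longleftrightarrow>
     rhoC (cl_h z) * (rN (nd_hp z) ^ (n + 1) - rN (nd_h z) ^ (n + 1)) =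
     rhoC (cl z) * (rN (nd_p z) ^ (n + 1) - rN (nd z) ^ (n + 1))"

definition eq_momentum :: "nat \<Rightarrow> stencil \<Rightarrow> bool" where
  "eq_momentum n z \<longleftrightarrow>
     (uN (nd_h z) - uN (nd z)) / tau z =
     - ((rhoC (cl_h z) / rhoC (cl z)) powr (2 / (real n + 1)) * rN (nd z) ^ n *
        ((pC (cl z) - pC (cl_m z)) / hs z))"

definition eq_entropy :: "nat \<Rightarrow> stencil \<Rightarrow> bool" where
  "eq_entropy n z \<longleftrightarrow>
     pC (cl_h z) / rhoC (cl_h z) powr ((real n + 3) / (real n + 1)) =
     pC (cl z) / rhoC (cl z) powr ((real n + 3) / (real n + 1))"

text \<open>The equation for \<open>r\<close> at both nodes of the stencil where its two layers are present.\<close>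

definition eq_trajectory :: "stencil \<Rightarrow> bool" where
  "eq_trajectory z \<longleftrightarrow>
     (rN (nd_h z) - rN (nd z)) / tau z = uN (nd z) \<and>
     (rN (nd_hp z) - rN (nd_p z)) / tau z = uN (nd_p z)"

definition scheme :: "nat \<Rightarrow> stencil set" where
  "scheme n = {z. orthogonal_mesh z \<and> positive_state z \<and>
     eq_mass n z \<and> eq_momentum n z \<and> eq_entropy n z \<and> eq_trajectory z}"

text \<open>Coefficients of \<open>\<partial>\<^sub>t, \<partial>\<^sub>s\<close> as functions of \<open>t s\<close>, of \<open>\<partial>\<^sub>u, \<partial>\<^sub>r\<close> as functions of \<open>t s u r\<close>
  and of \<open>\<partial>\<^sub>\<rho>, \<partial>\<^sub>p\<close> as functions of \<open>t s \<rho> p\<close>: exactly the variables available at the mesh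
  point where the coefficient has to be evaluated.\<close>

record generator =
  xi_t :: "real \<Rightarrow> real \<Rightarrow> real"
  xi_s :: "real \<Rightarrow> real \<Rightarrow> real"
  eta_u :: "real \<Rightarrow> real \<Rightarrow> real \<Rightarrow> real \<Rightarrow> real"
  eta_r :: "real \<Rightarrow> real \<Rightarrow> real \<Rightarrow> real \<Rightarrow> real"
  eta_rho :: "real \<Rightarrow> real \<Rightarrow> real \<Rightarrow> real \<Rightarrow> real"
  eta_p :: "real \<Rightarrow> real \<Rightarrow> real \<Rightarrow> real \<Rightarrow> real"

definition zero_gen :: generator where
  "zero_gen = \<lparr>xi_t = (\<lambda>t s. 0), xi_s = (\<lambda>t s. 0),
     eta_u = (\<lambda>t s u r. 0), eta_r = (\<lambda>t s u r. 0),
     eta_rho = (\<lambda>t s \<rho> p. 0), eta_p = (\<lambda>t s \<rho> p. 0)\<rparr>"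

definition X0 :: generator where
  "X0 = zero_gen\<lparr>xi_s := \<lambda>t s. 1\<rparr>"

definition X1 :: generator where
  "X1 = zero_gen\<lparr>xi_t := \<lambda>t s. 1\<rparr>"

definition X2 :: "nat \<Rightarrow> generator" where
  "X2 n = zero_gen\<lparr>xi_t := \<lambda>t s. t, xi_s := \<lambda>t s. (real n + 1) * s,
     eta_r := \<lambda>t s u r. r\<rparr>"

definition X3 :: "nat \<Rightarrow> generator" where
  "X3 n = zero_gen\<lparr>xi_t := \<lambda>t s. 2 * t, xi_s := \<lambda>t s. (real n + 3) * s,
     eta_u := \<lambda>t s u r. - u, eta_rho := \<lambda>t s \<rho> p. 2 * \<rho>, eta_r := \<lambda>t s u r. r\<rparr>"

definition X4 :: generator where
  "X4 = zero_gen\<lparr>xi_s := \<lambda>t s. s, eta_rho := \<lambda>t s \<rho> p. \<rho>, eta_p := \<lambda>t s \<rho> p. p\<rparr>"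

definition X_star :: "nat \<Rightarrow> generator" where
  "X_star n = zero_gen\<lparr>xi_t := \<lambda>t s. t\<^sup>2, eta_u := \<lambda>t s u r. r - t * u,
     eta_rho := \<lambda>t s \<rho> p. - (real n + 1) * t * \<rho>,
     eta_p := \<lambda>t s \<rho> p. - (real n + 3) * t * p, eta_r := \<lambda>t s u r. t * r\<rparr>"

definition node_orbit :: "generator \<Rightarrow> real set \<Rightarrow> (real \<Rightarrow> node) \<Rightarrow> bool" where
  "node_orbit X I c \<longleftrightarrow> (\<forall>a\<in>I.
     ((\<lambda>a. tN (c a)) has_real_derivative xi_t X (tN (c a)) (sN (c a))) (at a) \<and>
     ((\<lambda>a. sN (c a)) has_real_derivative xi_s X (tN (c a)) (sN (c a))) (at a) \<and>
     ((\<lambda>a. uN (c a)) has_real_derivative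
        eta_u X (tN (c a)) (sN (c a)) (uN (c a)) (rN (c a))) (at a) \<and>
     ((\<lambda>a. rN (c a)) has_real_derivative
        eta_r X (tN (c a)) (sN (c a)) (uN (c a)) (rN (c a))) (at a))"

definition cell_orbit :: "generator \<Rightarrow> real set \<Rightarrow> (real \<Rightarrow> cell) \<Rightarrow> bool" where
  "cell_orbit X I c \<longleftrightarrow> (\<forall>a\<in>I.
     ((\<lambda>a. tC (c a)) has_real_derivative xi_t X (tC (c a)) (sC (c a))) (at a) \<and>
     ((\<lambda>a. sC (c a)) has_real_derivative xi_s X (tC (c a)) (sC (c a))) (at a) \<and>
     ((\<lambda>a. rhoC (c a)) has_real_derivative
        eta_rho X (tC (c a)) (sC (c a)) (rhoC (c a)) (pC (c a))) (at a) \<and>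
     ((\<lambda>a. pC (c a)) has_real_derivative
        eta_p X (tC (c a)) (sC (c a)) (rhoC (c a)) (pC (c a))) (at a))"

text \<open>Orbit of the local one-parameter group acting simultaneously on all stencil variables.\<close>

definition orbit :: "generator \<Rightarrow> real set \<Rightarrow> (real \<Rightarrow> stencil) \<Rightarrow> bool" where
  "orbit X I c \<longleftrightarrow> open I \<and> is_interval I \<and> 0 \<in> I \<and>
     node_orbit X I (\<lambda>a. nd (c a)) \<and> node_orbit X I (\<lambda>a. nd_p (c a)) \<and>
     node_orbit X I (\<lambda>a. nd_h (c a)) \<and> node_orbit X I (\<lambda>a. nd_hp (c a)) \<and>
     cell_orbit X I (\<lambda>a. cl (c a)) \<and> cell_orbit X I (\<lambda>a. cl_m (c a)) \<and>
     cell_orbit X I (\<lambda>a. cl_h (c a))"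

text \<open>The group element with parameter \<open>a\<close> maps \<open>z\<close> to \<open>w\<close>. The group is local: \<open>a\<close> is
  restricted to the interval around \<open>0\<close> on which the orbit of \<open>z\<close> exists.\<close>

definition group_maps :: "generator \<Rightarrow> real \<Rightarrow> stencil \<Rightarrow> stencil \<Rightarrow> bool" where
  "group_maps X a z w \<longleftrightarrow> (\<exists>I c. orbit X I c \<and> c 0 = z \<and> a \<in> I \<and> c a = w)"

text \<open>The first conjunct (the orbit of every point of \<open>S\<close> exists) excludes vacuous invariance.\<close>

definition invariant_under :: "generator \<Rightarrow> stencil set \<Rightarrow> bool" where
  "invariant_under X S \<longleftrightarrow>
     (\<forall>z\<in>S. (\<exists>I c. orbit X I c \<and> c 0 = z) \<and> (\<forall>a w. group_maps X a z w \<longrightarrow> w \<in> S))"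

text \<open>\<open>R\<close> as a function of \<open>r\<close> and \<open>r\<close>-hat. For equal arguments (that is, \<open>u = 0\<close>) the quotient
  is \<open>0\<close> instead of its limit \<open>r ^ n\<close>; only the product \<open>R * u\<close> is used, and it is \<open>0\<close> then
  in either reading.\<close>

definition R_coeff :: "nat \<Rightarrow> real \<Rightarrow> real \<Rightarrow> real" where
  "R_coeff n r rh = (rh ^ (n + 1) - r ^ (n + 1)) / ((real n + 1) * (rh - r))"

definition eq_mass_divergence :: "nat \<Rightarrow> stencil \<Rightarrow> bool" where
  "eq_mass_divergence n z \<longleftrightarrow>
     1 / tau z * (1 / rhoC (cl_h z) - 1 / rhoC (cl z)) =
     (R_coeff n (rN (nd_p z)) (rN (nd_hp z)) * uN (nd_p z)
      - R_coeff n (rN (nd z)) (rN (nd_h z)) * uN (nd z)) / hs z"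

end

theory Submission
  imports Defs
begin

text \<open>Each generator integrates explicitly: translations, scalings, and for \<open>X_star\<close> the projective
  map \<open>t / (1 - a t)\<close>, under which the density and pressure pick up the factors \<open>(1 - a t)^(n+1)\<close>
  and \<open>(1 - a t)^(n+3)\<close>. The exponents \<open>2/(n+1)\<close> and \<open>(n+3)/(n+1)\<close> are exactly those for which
  these factors cancel in the momentum and entropy equations, and the trajectory equation makes
  the increment of \<open>u\<close> transform by a single factor. Integral curves are unique, so the orbits
  coincide with these explicit maps.\<close>

section \<open>Stencil maps and a criterion for invariance\<close>

definition map_stencil :: "(node \<Rightarrow> node) \<Rightarrow> (cell \<Rightarrow> cell) \<Rightarrow> stencil \<Rightarrow> stencil" where
  "map_stencil f g z = \<lparr>nd = f (nd z), nd_p = f (nd_p z), nd_h = f (nd_h z), nd_hp = f (nd_hp z),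
     cl = g (cl z), cl_m = g (cl_m z), cl_h = g (cl_h z)\<rparr>"

lemma map_stencil_sel [simp]:
  "nd (map_stencil f g z) = f (nd z)" "nd_p (map_stencil f g z) = f (nd_p z)"
  "nd_h (map_stencil f g z) = f (nd_h z)" "nd_hp (map_stencil f g z) = f (nd_hp z)"
  "cl (map_stencil f g z) = g (cl z)" "cl_m (map_stencil f g z) = g (cl_m z)"
  "cl_h (map_stencil f g z) = g (cl_h z)"
  by (simp_all add: map_stencil_def)

lemma node_orbit_subset: "node_orbit X J c \<Longrightarrow> I \<subseteq> J \<Longrightarrow> node_orbit X I c"
  unfolding node_orbit_def by blast

lemma cell_orbit_subset: "cell_orbit X J c \<Longrightarrow> I \<subseteq> J \<Longrightarrow> cell_orbit X I c"
  unfolding cell_orbit_def by blast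

text \<open>\<open>D t\<close> is the parameter interval on which the flow of a point at time \<open>t\<close> exists.\<close>

lemma invariant_underI:
  fixes D :: "real \<Rightarrow> real set"
  assumes D: "\<And>t. open (D t)" "\<And>t. is_interval (D t)" "\<And>t. 0 \<in> D t"
    and zero: "\<And>x. F 0 x = x" "\<And>y. G 0 y = y"
    and node_flow: "\<And>x. node_orbit X (D (tN x)) (\<lambda>a. F a x)"
    and cell_flow: "\<And>y. cell_orbit X (D (tC y)) (\<lambda>a. G a y)"
    and node_unique: "\<And>I c a. node_orbit X I c \<Longrightarrow> is_interval I \<Longrightarrow> 0 \<in> I \<Longrightarrow> a \<in> I \<Longrightarrow>
      a \<in> D (tN (c 0)) \<and> c a = F a (c 0)"
    and cell_unique: "\<And>I c a. cell_orbit X I c \<Longrightarrow> is_interval I \<Longrightarrow> 0 \<in> I \<Longrightarrow> a \<in> I \<Longrightarrow>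
      a \<in> D (tC (c 0)) \<and> c a = G a (c 0)"
    and closed: "\<And>z a. z \<in> S \<Longrightarrow> a \<in> D (tN (nd z)) \<Longrightarrow> a \<in> D (tN (nd_h z)) \<Longrightarrow>
      map_stencil (F a) (G a) z \<in> S"
  shows "invariant_under X S"
  unfolding invariant_under_def
proof (intro ballI conjI allI impI)
  fix z assume "z \<in> S"
  \<comment> \<open>The group acts on all seven points with a common parameter, so the orbit of the
    stencil lives on the intersection of their seven parameter intervals.\<close>
  define I where "I = D (tN (nd z)) \<inter> D (tN (nd_p z)) \<inter> D (tN (nd_h z)) \<inter> D (tN (nd_hp z))
    \<inter> D (tC (cl z)) \<inter> D (tC (cl_m z)) \<inter> D (tC (cl_h z))"
  have I: "open I" "is_interval I" "0 \<in> I"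
    unfolding I_def using D by (auto intro!: open_Int is_interval_Int)
  have "orbit X I (\<lambda>a. map_stencil (F a) (G a) z)"
    unfolding orbit_def map_stencil_sel using I
    by (intro conjI node_orbit_subset[OF node_flow] cell_orbit_subset[OF cell_flow])
       (auto simp: I_def)
  moreover have "map_stencil (F 0) (G 0) z = z"
    by (simp add: map_stencil_def zero)
  ultimately show "\<exists>I c. orbit X I c \<and> c 0 = z" by blast
next
  fix z a w assume z: "z \<in> S" and "group_maps X a z w"
  then obtain I c where o: "orbit X I c" and c: "c 0 = z" "a \<in> I" "c a = w"
    unfolding group_maps_def by blast
  have I: "is_interval I" "0 \<in> I" using o by (auto simp: orbit_def)
  note N = node_unique[OF _ I c(2)] and C = cell_unique[OF _ I c(2)]
  have orbs: "node_orbit X I (\<lambda>a. nd (c a))" "node_orbit X I (\<lambda>a. nd_p (c a))"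
    "node_orbit X I (\<lambda>a. nd_h (c a))" "node_orbit X I (\<lambda>a. nd_hp (c a))"
    "cell_orbit X I (\<lambda>a. cl (c a))" "cell_orbit X I (\<lambda>a. cl_m (c a))"
    "cell_orbit X I (\<lambda>a. cl_h (c a))"
    using o by (simp_all add: orbit_def)
  note pts = N[OF orbs(1)] N[OF orbs(2)] N[OF orbs(3)] N[OF orbs(4)]
    C[OF orbs(5)] C[OF orbs(6)] C[OF orbs(7)]
  have "w = map_stencil (F a) (G a) z"
    using pts unfolding c by (intro stencil.equality) simp_all
  \<comment> \<open>One node per time layer is enough: on a flat mesh the remaining points share
    these two times.\<close>
  moreover have "a \<in> D (tN (nd z))" "a \<in> D (tN (nd_h z))"
    using pts(1,3) unfolding c by simp_all
  ultimately show "w \<in> S" using closed[OF z] by simp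
qed

section \<open>Uniqueness for the scalar differential equations of the flows\<close>

lemma DERIV_zero_on_interval:
  fixes f :: "real \<Rightarrow> real"
  assumes "is_interval I" "a \<in> I" "b \<in> I"
    and "\<And>x. x \<in> I \<Longrightarrow> (f has_real_derivative 0) (at x within I)"
  shows "f a = f b"
  using has_field_derivative_zero_constant[of I f] assms
  by (metis is_interval_convex_1)

text \<open>The product rule gives \<open>k * f * g - f * k * g = 0\<close>. Pairing an unknown
  solution with a known solution of the adjoint equation thus determines it by its initial value.
  Derivatives are taken within \<open>I\<close> so that closed intervals qualify too.\<close>

lemma ODE_product_constant:
  fixes f g k :: "real \<Rightarrow> real"
  assumes "is_interval I" "0 \<in> I" "a \<in> I"
    and f: "\<And>x. x \<in> I \<Longrightarrow> (f has_real_derivative k x * f x) (at x within I)"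
    and g: "\<And>x. x \<in> I \<Longrightarrow> (g has_real_derivative - k x * g x) (at x within I)"
  shows "f a * g a = f 0 * g 0"
proof (rule DERIV_zero_on_interval[OF assms(1,3,2)])
  fix x assume "x \<in> I"
  show "((\<lambda>x. f x * g x) has_real_derivative 0) (at x within I)"
    using DERIV_mult[OF f[OF \<open>x \<in> I\<close>] g[OF \<open>x \<in> I\<close>]] by (simp add: algebra_simps)
qed

lemma ODE_exponential:
  fixes f :: "real \<Rightarrow> real"
  assumes "is_interval I" "0 \<in> I" "a \<in> I"
    and f: "\<And>x. x \<in> I \<Longrightarrow> (f has_real_derivative k * f x) (at x)"
  shows "f a = exp (k * a) * f 0"
proof -
  have "f a * exp (- (k * a)) = f 0 * exp (- (k * 0))"
    by (rule ODE_product_constant[where k = "\<lambda>_. k", OF assms(1-3)])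
       (auto intro!: derivative_eq_intros has_field_derivative_at_within[OF f])
  then show ?thesis by (simp add: exp_minus field_simps)
qed

lemma ODE_linear:
  fixes f :: "real \<Rightarrow> real"
  assumes "is_interval I" "0 \<in> I" "a \<in> I"
    and f: "\<And>x. x \<in> I \<Longrightarrow> (f has_real_derivative k) (at x)"
  shows "f a = f 0 + k * a"
proof -
  have "f a - k * a = f 0 - k * 0"
    by (rule DERIV_zero_on_interval[OF assms(1,3,2)])
       (auto intro!: derivative_eq_intros has_field_derivative_at_within[OF f])
  then show ?thesis by simp
qed

text \<open>Integrating \<open>1 / t\<close> would require \<open>t\<close> to have no zeros; the
  polynomial form of the solution avoids that division. The positivity says that no solution reaches
  the pole \<open>1 / t 0\<close>.\<close>

lemma ODE_square:
  fixes t :: "real \<Rightarrow> real"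
  assumes I: "is_interval I" "0 \<in> I" "a \<in> I"
    and t: "\<And>x. x \<in> I \<Longrightarrow> (t has_real_derivative (t x)\<^sup>2) (at x)"
  shows "t a * (1 - a * t 0) = t 0" and "1 - a * t 0 > 0"
proof -
  \<comment> \<open>The closed interval between \<open>0\<close> and \<open>a\<close>, on either
    side of \<open>0\<close>; on it the continuous function \<open>t\<close> has an
    antiderivative.\<close>
  define J where "J = {min 0 a..max 0 a}"
  have J: "is_interval J" "0 \<in> J" "a \<in> J" by (auto simp: J_def)
  have JI: "J \<subseteq> I"
  proof
    fix x assume "x \<in> J"
    then show "x \<in> I"
      using mem_is_interval_1_I[OF I, of x] mem_is_interval_1_I[OF I(1,3,2), of x]
      by (cases "0 \<le> a") (auto simp: J_def)
  qed
  have tJ: "(t has_real_derivative (t x)\<^sup>2) (at x within J)" if "x \<in> J" for x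
    using JI that by (intro has_field_derivative_at_within[OF t]) auto
  have "continuous_on J t"
    by (rule DERIV_continuous_on[OF tJ])
  \<comment> \<open>\<open>exp T\<close> and \<open>exp (- T)\<close> serve below as integrating
    factors.\<close>
  then obtain T where "\<And>x. x \<in> J \<Longrightarrow> (T has_vector_derivative t x) (at x within J)"
    unfolding J_def using antiderivative_continuous by blast
  then have T: "\<And>x. x \<in> J \<Longrightarrow> (T has_real_derivative t x) (at x within J)"
    by (simp add: has_real_derivative_iff_has_vector_derivative)
  \<comment> \<open>The defect \<open>g = t (1 - x t 0) - t 0\<close> solves the linear equation \<open>g' = t g\<close> with \<open>g 0 = 0\<close>.\<close>
  have main: "t b * (1 - b * t 0) = t 0" if "b \<in> J" for b
  proof -
    have "(t b * (1 - b * t 0) - t 0) * exp (- T b) = (t 0 * (1 - 0 * t 0) - t 0) * exp (- T 0)"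
      by (rule ODE_product_constant[where k = t, OF J(1,2) that])
         (auto intro!: derivative_eq_intros tJ T simp: power2_eq_square algebra_simps)
    then show ?thesis by simp
  qed
  then show "t a * (1 - a * t 0) = t 0" using J by blast
  \<comment> \<open>So \<open>1 - x t 0\<close> equals \<open>exp (T 0 - T x)\<close> and cannot vanish while the orbit exists.\<close>
  have "exp (T a) * (1 - a * t 0) = exp (T 0) * (1 - 0 * t 0)"
    by (rule ODE_product_constant[where k = t, OF J])
       (auto intro!: derivative_eq_intros T simp: main)
  then have "exp (T a) * (1 - a * t 0) > 0" by simp
  then show "1 - a * t 0 > 0" by (simp add: zero_less_mult_iff)
qed

subsection \<open>Translations\<close>

text \<open>A common form of \<open>X0\<close> and \<open>X1\<close>.\<close>

definition translation_gen :: "real \<Rightarrow> real \<Rightarrow> generator" where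
  "translation_gen bt bs = zero_gen\<lparr>xi_t := \<lambda>t s. bt, xi_s := \<lambda>t s. bs\<rparr>"

definition translate_node :: "real \<Rightarrow> real \<Rightarrow> node \<Rightarrow> node" where
  "translate_node bt bs x = x\<lparr>tN := tN x + bt, sN := sN x + bs\<rparr>"

definition translate_cell :: "real \<Rightarrow> real \<Rightarrow> cell \<Rightarrow> cell" where
  "translate_cell bt bs y = y\<lparr>tC := tC y + bt, sC := sC y + bs\<rparr>"

text \<open>The coordinates enter the scheme only through differences and through relations between
  points that a common shift preserves.\<close>

lemma scheme_translate:
  "z \<in> scheme n \<Longrightarrow> map_stencil (translate_node bt bs) (translate_cell bt bs) z \<in> scheme n"
  by (simp add: scheme_def orthogonal_mesh_def positive_state_def eq_mass_def eq_momentum_def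
      eq_entropy_def eq_trajectory_def tau_def hs_def translate_node_def translate_cell_def)

lemma invariant_translation: "invariant_under (translation_gen bt bs) (scheme n)"
proof (rule invariant_underI[where D = "\<lambda>_. UNIV"
      and F = "\<lambda>a. translate_node (bt * a) (bs * a)" and G = "\<lambda>a. translate_cell (bt * a) (bs * a)"])
  fix I :: "real set" and a :: real
  assume I: "is_interval I" "0 \<in> I" "a \<in> I"
  { fix c assume "node_orbit (translation_gen bt bs) I c"
    then show "a \<in> UNIV \<and> c a = translate_node (bt * a) (bs * a) (c 0)"
      using ODE_linear[OF I, of "\<lambda>a. tN (c a)" bt] ODE_linear[OF I, of "\<lambda>a. sN (c a)" bs]
        ODE_linear[OF I, of "\<lambda>a. uN (c a)" 0] ODE_linear[OF I, of "\<lambda>a. rN (c a)" 0]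
      by (auto simp: node_orbit_def translation_gen_def zero_gen_def translate_node_def
          intro!: node.equality) }
  { fix c assume "cell_orbit (translation_gen bt bs) I c"
    then show "a \<in> UNIV \<and> c a = translate_cell (bt * a) (bs * a) (c 0)"
      using ODE_linear[OF I, of "\<lambda>a. tC (c a)" bt] ODE_linear[OF I, of "\<lambda>a. sC (c a)" bs]
        ODE_linear[OF I, of "\<lambda>a. rhoC (c a)" 0] ODE_linear[OF I, of "\<lambda>a. pC (c a)" 0]
      by (auto simp: cell_orbit_def translation_gen_def zero_gen_def translate_cell_def
          intro!: cell.equality) }
next
  fix z a assume "z \<in> scheme n"
  then show "map_stencil (translate_node (bt * a) (bs * a)) (translate_cell (bt * a) (bs * a)) z
      \<in> scheme n"
    by (rule scheme_translate)
qed (auto simp: node_orbit_def cell_orbit_def translation_gen_def zero_gen_def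
      translate_node_def translate_cell_def
      intro!: derivative_eq_intros)

subsection \<open>Scalings\<close>

text \<open>A common form of \<open>X2\<close>, \<open>X3\<close> and \<open>X4\<close>, which are
  diagonal linear fields; the parameters are their weights.\<close>

definition scaling_gen :: "real \<Rightarrow> real \<Rightarrow> real \<Rightarrow> real \<Rightarrow> real \<Rightarrow> real \<Rightarrow> generator" where
  "scaling_gen kt ks ku kr k\<rho> kp = \<lparr>xi_t = \<lambda>t s. kt * t, xi_s = \<lambda>t s. ks * s,
     eta_u = \<lambda>t s u r. ku * u, eta_r = \<lambda>t s u r. kr * r,
     eta_rho = \<lambda>t s \<rho> p. k\<rho> * \<rho>, eta_p = \<lambda>t s \<rho> p. kp * p\<rparr>"

definition scale_node :: "real \<Rightarrow> real \<Rightarrow> real \<Rightarrow> real \<Rightarrow> node \<Rightarrow> node" where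
  "scale_node At As Au Ar x = \<lparr>tN = At * tN x, sN = As * sN x, uN = Au * uN x, rN = Ar * rN x\<rparr>"

definition scale_cell :: "real \<Rightarrow> real \<Rightarrow> real \<Rightarrow> real \<Rightarrow> cell \<Rightarrow> cell" where
  "scale_cell At As A\<rho> Ap y =
     \<lparr>tC = At * tC y, sC = As * sC y, rhoC = A\<rho> * rhoC y, pC = Ap * pC y\<rparr>"

text \<open>The two relations balance the factors in the trajectory and momentum equations. Mass and
  entropy equations are homogeneous, and the momentum equation contains only the ratio of densities,
  so \<open>A\<rho>\<close> is unrestricted beyond its sign.\<close>

lemma scheme_scale:
  assumes z: "z \<in> scheme n"
    and pos: "At > 0" "As > 0" "Ar > 0" "A\<rho> > 0" "Ap > 0"
    and Ar: "Ar = At * Au" and Au: "Au * As = At * Ar ^ n * Ap"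
  shows "map_stencil (scale_node At As Au Ar) (scale_cell At As A\<rho> Ap) z \<in> scheme n"
    (is "?w \<in> _")
proof -
  have tau: "tau ?w = At * tau z" and hs: "hs ?w = As * hs z"
    by (simp_all add: tau_def hs_def scale_node_def right_diff_distrib)
  have mesh: "orthogonal_mesh z" and st: "positive_state z" and eqs: "eq_mass n z"
    "eq_momentum n z" "eq_entropy n z" "eq_trajectory z"
    using z by (auto simp: scheme_def)
  have m: "orthogonal_mesh ?w"
    using mesh pos unfolding orthogonal_mesh_def tau hs
    by (simp add: scale_node_def scale_cell_def distrib_left right_diff_distrib)
  have p: "positive_state ?w"
    using st pos by (simp add: positive_state_def scale_node_def scale_cell_def)
  have e1: "eq_mass n ?w"
  proof -
    have "rhoC (cl_h ?w) * (rN (nd_hp ?w) ^ (n + 1) - rN (nd_h ?w) ^ (n + 1)) =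
      A\<rho> * Ar ^ (n + 1) * (rhoC (cl_h z) * (rN (nd_hp z) ^ (n + 1) - rN (nd_h z) ^ (n + 1)))"
      by (simp add: scale_node_def scale_cell_def power_mult_distrib algebra_simps)
    also have "\<dots> = rhoC (cl ?w) * (rN (nd_p ?w) ^ (n + 1) - rN (nd ?w) ^ (n + 1))"
      unfolding eqs(1)[unfolded eq_mass_def]
      by (simp add: scale_node_def scale_cell_def power_mult_distrib algebra_simps)
    finally show ?thesis by (simp add: eq_mass_def)
  qed
  have e2: "eq_momentum n ?w"
  proof -
    have k: "Au / At = Ar ^ n * (Ap / As)"
      using Au pos by (simp add: field_simps)
    have "(uN (nd_h ?w) - uN (nd ?w)) / tau ?w = Au / At * ((uN (nd_h z) - uN (nd z)) / tau z)"
      unfolding tau by (simp add: scale_node_def right_diff_distrib[symmetric])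
    also have "\<dots> = - ((rhoC (cl_h z) / rhoC (cl z)) powr (2 / (real n + 1)) *
      (Ar * rN (nd z)) ^ n * ((Ap * pC (cl z) - Ap * pC (cl_m z)) / (As * hs z)))"
      using eqs(2) unfolding eq_momentum_def k
      by (simp add: power_mult_distrib right_diff_distrib[symmetric])
    finally show ?thesis
      using pos unfolding eq_momentum_def hs by (simp add: scale_node_def scale_cell_def)
  qed
  have e3: "eq_entropy n ?w"
  proof -
    \<comment> \<open>Both layers acquire the same prefactor, whatever the exponent is.\<close>
    have "Ap * b / (A\<rho> * d) powr g = Ap / A\<rho> powr g * (b / d powr g)" for b d g
      by (simp add: powr_mult)
    then show ?thesis
      using eqs(3) unfolding eq_entropy_def
      by (simp only: map_stencil_sel scale_cell_def cell.select_convs)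
  qed
  have e4: "eq_trajectory ?w"
  proof -
    have "(Ar * y - Ar * x) / (At * tau z) = Au * ((y - x) / tau z)" for x y
      using pos by (simp add: Ar right_diff_distrib[symmetric])
    then show ?thesis
      using eqs(4) by (simp only: eq_trajectory_def tau map_stencil_sel scale_node_def node.select_convs)
  qed
  show ?thesis using m p e1 e2 e3 e4 by (simp add: scheme_def)
qed

text \<open>The conditions on the weights are the logarithms of the two relations between the
  factors in \<open>scheme_scale\<close>.\<close>

lemma invariant_scaling:
  assumes kr: "kr = kt + ku" and ku: "ku + ks = kt + real n * kr + kp"
  shows "invariant_under (scaling_gen kt ks ku kr k\<rho> kp) (scheme n)"
proof (rule invariant_underI[where D = "\<lambda>_. UNIV"
      and F = "\<lambda>a. scale_node (exp (kt * a)) (exp (ks * a)) (exp (ku * a)) (exp (kr * a))"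
      and G = "\<lambda>a. scale_cell (exp (kt * a)) (exp (ks * a)) (exp (k\<rho> * a)) (exp (kp * a))"])
  fix I :: "real set" and a :: real
  assume I: "is_interval I" "0 \<in> I" "a \<in> I"
  { fix c assume "node_orbit (scaling_gen kt ks ku kr k\<rho> kp) I c"
    then show "a \<in> UNIV \<and> c a =
      scale_node (exp (kt * a)) (exp (ks * a)) (exp (ku * a)) (exp (kr * a)) (c 0)"
      using ODE_exponential[OF I, of "\<lambda>a. tN (c a)" kt] ODE_exponential[OF I, of "\<lambda>a. sN (c a)" ks]
        ODE_exponential[OF I, of "\<lambda>a. uN (c a)" ku] ODE_exponential[OF I, of "\<lambda>a. rN (c a)" kr]
      by (auto simp: node_orbit_def scaling_gen_def scale_node_def intro!: node.equality) }
  { fix c assume "cell_orbit (scaling_gen kt ks ku kr k\<rho> kp) I c"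
    then show "a \<in> UNIV \<and> c a =
      scale_cell (exp (kt * a)) (exp (ks * a)) (exp (k\<rho> * a)) (exp (kp * a)) (c 0)"
      using ODE_exponential[OF I, of "\<lambda>a. tC (c a)" kt] ODE_exponential[OF I, of "\<lambda>a. sC (c a)" ks]
        ODE_exponential[OF I, of "\<lambda>a. rhoC (c a)" k\<rho>] ODE_exponential[OF I, of "\<lambda>a. pC (c a)" kp]
      by (auto simp: cell_orbit_def scaling_gen_def scale_cell_def intro!: cell.equality) }
next
  fix z a assume "z \<in> scheme n"
  have "exp (ku * a) * exp (ks * a) = exp ((kt + real n * kr + kp) * a)"
    unfolding ku[symmetric] by (simp add: exp_add[symmetric] algebra_simps)
  then have "exp (ku * a) * exp (ks * a) = exp (kt * a) * exp (kr * a) ^ n * exp (kp * a)"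
    by (simp add: exp_add[symmetric] exp_of_nat_mult[symmetric] algebra_simps)
  moreover have "exp (kr * a) = exp (kt * a) * exp (ku * a)"
    by (simp add: kr exp_add[symmetric] algebra_simps)
  ultimately show "map_stencil
      (scale_node (exp (kt * a)) (exp (ks * a)) (exp (ku * a)) (exp (kr * a)))
      (scale_cell (exp (kt * a)) (exp (ks * a)) (exp (k\<rho> * a)) (exp (kp * a))) z \<in> scheme n"
    using scheme_scale[OF \<open>z \<in> scheme n\<close>] by simp
qed (auto simp: node_orbit_def cell_orbit_def scaling_gen_def scale_node_def scale_cell_def
      intro!: derivative_eq_intros)

subsection \<open>The projective generator\<close>

text \<open>The \<open>uN\<close> component is what the velocity \<open>dr/dt\<close> becomes when
  both \<open>t\<close> and \<open>r\<close> are divided by \<open>1 - a * t\<close>.\<close>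

definition proj_node :: "real \<Rightarrow> node \<Rightarrow> node" where
  "proj_node a x = \<lparr>tN = tN x / (1 - a * tN x), sN = sN x,
     uN = (1 - a * tN x) * uN x + a * rN x, rN = rN x / (1 - a * tN x)\<rparr>"

definition proj_cell :: "nat \<Rightarrow> real \<Rightarrow> cell \<Rightarrow> cell" where
  "proj_cell n a y = \<lparr>tC = tC y / (1 - a * tC y), sC = sC y,
     rhoC = (1 - a * tC y) ^ (n + 1) * rhoC y, pC = (1 - a * tC y) ^ (n + 3) * pC y\<rparr>"

text \<open>With \<open>m = n + 1\<close>, the fractional exponents of the scheme turn the density
  factors into natural powers.\<close>

lemma power_powr_quotient:
  fixes q :: real
  assumes "q > 0" "m > 0"
  shows "(q ^ m) powr (real k / real m) = q ^ k"
  using assms by (simp add: powr_realpow[symmetric] powr_powr)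

text \<open>Positivity of \<open>1 - a * t\<close> on both layers preserves the sign of the time
  step and of \<open>r\<close>, \<open>\<rho>\<close> and \<open>p\<close>. The equations then
  reduce to counting powers of the two factors.\<close>

lemma scheme_proj:
  assumes z: "z \<in> scheme n" and q: "1 - a * tN (nd z) > 0" and qh: "1 - a * tN (nd_h z) > 0"
  shows "map_stencil (proj_node a) (proj_cell n a) z \<in> scheme n" (is "?w \<in> _")
proof -
  define Q where "Q = 1 - a * tN (nd z)"
  define H where "H = 1 - a * tN (nd_h z)"
  have QH: "Q > 0" "H > 0" using q qh by (simp_all add: Q_def H_def)
  have mesh: "orthogonal_mesh z" and st: "positive_state z" and eqs: "eq_mass n z"
    "eq_momentum n z" "eq_entropy n z" "eq_trajectory z"
    using z by (auto simp: scheme_def)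
  have t: "tN (nd_p z) = tN (nd z)" "tC (cl z) = tN (nd z)" "tC (cl_m z) = tN (nd z)"
    "tN (nd_hp z) = tN (nd_h z)" "tC (cl_h z) = tN (nd_h z)" and tau_pos: "tau z > 0"
    using mesh by (simp_all add: orthogonal_mesh_def)
  have HQ: "H = Q - a * tau z" by (simp add: H_def Q_def tau_def algebra_simps)
  \<comment> \<open>Over the common denominator the terms with the product of the two times
    cancel.\<close>
  have tau: "tau ?w = tau z / (Q * H)"
    using QH unfolding tau_def Q_def H_def by (simp add: proj_node_def field_simps)
  have hs: "hs ?w = hs z" by (simp add: hs_def proj_node_def)
  have traj: "rN (nd_h z) = rN (nd z) + tau z * uN (nd z)"
    "rN (nd_hp z) = rN (nd_p z) + tau z * uN (nd_p z)"
    using eqs(4) tau_pos by (auto simp: eq_trajectory_def field_simps)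
  have sel: "uN (nd ?w) = Q * uN (nd z) + a * rN (nd z)"
    "uN (nd_p ?w) = Q * uN (nd_p z) + a * rN (nd_p z)"
    "uN (nd_h ?w) = H * uN (nd_h z) + a * rN (nd_h z)"
    "rN (nd ?w) = rN (nd z) / Q" "rN (nd_p ?w) = rN (nd_p z) / Q"
    "rN (nd_h ?w) = rN (nd_h z) / H" "rN (nd_hp ?w) = rN (nd_hp z) / H"
    "rhoC (cl ?w) = Q ^ (n + 1) * rhoC (cl z)" "rhoC (cl_m ?w) = Q ^ (n + 1) * rhoC (cl_m z)"
    "rhoC (cl_h ?w) = H ^ (n + 1) * rhoC (cl_h z)"
    "pC (cl ?w) = Q ^ (n + 3) * pC (cl z)" "pC (cl_m ?w) = Q ^ (n + 3) * pC (cl_m z)"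
    "pC (cl_h ?w) = H ^ (n + 3) * pC (cl_h z)"
    by (simp_all add: proj_node_def proj_cell_def Q_def H_def t)
  have m: "orthogonal_mesh ?w"
    using mesh QH unfolding orthogonal_mesh_def tau hs by (simp add: proj_node_def proj_cell_def)
  have p: "positive_state ?w"
    using st QH unfolding positive_state_def sel by simp
  \<comment> \<open>For \<open>q = Q ^ (n + 1)\<close> or \<open>q = H ^ (n + 1)\<close> the density
    factor cancels the denominators of the powers of \<open>r\<close>.\<close>
  have mass: "(q * q') * (x / q - y / q) = q' * (x - y)" if "q \<noteq> 0" for q q' x y :: real
    using that by (simp add: field_simps)
  have e1: "eq_mass n ?w"
    using eqs(1) QH unfolding eq_mass_def sel power_divide
    by (simp add: mass del: power_Suc)
  have e2: "eq_momentum n ?w"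
  proof -
    let ?g = "(rhoC (cl_h z) / rhoC (cl z)) powr (2 / (real n + 1))"
    have k: "((H / Q) ^ (n + 1)) powr (2 / (real n + 1)) = (H / Q)\<^sup>2"
      using power_powr_quotient[of "H / Q" "n + 1" 2] QH by (simp add: add.commute)
    have ratio: "rhoC (cl_h ?w) / rhoC (cl ?w) = (H / Q) ^ (n + 1) * (rhoC (cl_h z) / rhoC (cl z))"
      unfolding sel by (simp add: power_divide)
    have g: "(rhoC (cl_h ?w) / rhoC (cl ?w)) powr (2 / (real n + 1)) = (H / Q)\<^sup>2 * ?g"
      unfolding ratio k[symmetric]
      by (rule powr_mult)
    \<comment> \<open>By the trajectory equation the increment of \<open>a * r\<close> is
      \<open>a * tau z * u\<close>, and \<open>Q - a * tau z = H\<close> turns the factor of the old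
      velocity into that of the new one.\<close>
    have "uN (nd_h ?w) - uN (nd ?w) = H * (uN (nd_h z) - uN (nd z))"
      unfolding sel traj HQ by (simp add: algebra_simps)
    then have "(uN (nd_h ?w) - uN (nd ?w)) / tau ?w =
        H\<^sup>2 * Q * ((uN (nd_h z) - uN (nd z)) / tau z)"
      unfolding tau by (simp add: power2_eq_square)
    also have "\<dots> = - (H\<^sup>2 * Q * (?g * rN (nd z) ^ n * ((pC (cl z) - pC (cl_m z)) / hs z)))"
      using eqs(2) by (simp add: eq_momentum_def)
    \<comment> \<open>The factors on the right come from the density ratio, from
      \<open>r ^ n\<close> and from the pressure; the exponents of \<open>Q\<close> add up as
      \<open>-2 - n + (n + 3) = 1\<close>.\<close>
    also have "H\<^sup>2 * Q = (H / Q)\<^sup>2 * (1 / Q ^ n) * Q ^ (n + 3)"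
      using QH by (simp add: power_add power_divide power2_eq_square power3_eq_cube)
    finally show ?thesis
      unfolding eq_momentum_def g hs unfolding sel by (simp add: power_divide algebra_simps diff_divide_distrib)
  qed
  have e3: "eq_entropy n ?w"
  proof -
    \<comment> \<open>The entropy is invariant on each layer separately: the pressure factor equals
      the density factor raised to the adiabatic exponent.\<close>
    have "x ^ (n + 3) * b / (x ^ (n + 1) * d) powr ((real n + 3) / (real n + 1)) =
        b / d powr ((real n + 3) / (real n + 1))" if "x > 0" "d > 0" for x b d :: real
      using power_powr_quotient[of x "n + 1" "n + 3"] that
      by (simp add: powr_mult add.commute del: power_Suc)
    then show ?thesis
      using eqs(3) st QH unfolding eq_entropy_def positive_state_def sel by simp
  qed
  have e4: "eq_trajectory ?w"
  proof -
    \<comment> \<open>Stated for arbitrary \<open>x\<close>, \<open>y\<close>, \<open>v\<close> so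
      as to apply at both nodes; \<open>H = Q - a * tau z\<close> makes \<open>tau z\<close>
      cancel.\<close>
    have "(y / H - x / Q) / tau ?w = Q * v + a * x" if "y = x + tau z * v" for x y v
    proof -
      have "(y / H - x / Q) / tau ?w = (Q * y - H * x) / tau z"
        unfolding tau using QH tau_pos by (simp add: field_simps)
      also have "\<dots> = Q * v + a * x"
        unfolding that HQ using tau_pos by (simp add: field_simps)
      finally show ?thesis .
    qed
    then show ?thesis unfolding eq_trajectory_def sel using traj by blast
  qed
  show ?thesis using m p e1 e2 e3 e4 by (simp add: scheme_def)
qed

section \<open>Uniqueness of the orbits of \<open>X_star\<close>\<close>

text \<open>Along a solution, \<open>1 - x * t 0\<close> has logarithmic derivative
  \<open>- t x\<close>, so its inverse \<open>m\<close>-th power solves the adjoint equation. The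
  cases \<open>m = n + 1\<close>, \<open>m = n + 3\<close> and \<open>m = 1\<close> serve density,
  pressure and velocity.\<close>

lemma ODE_along_square:
  fixes t f :: "real \<Rightarrow> real"
  assumes I: "is_interval I" "0 \<in> I" "a \<in> I"
    and t: "\<And>x. x \<in> I \<Longrightarrow> (t has_real_derivative (t x)\<^sup>2) (at x)"
    and f: "\<And>x. x \<in> I \<Longrightarrow> (f has_real_derivative - real m * t x * f x) (at x)"
  shows "f a = (1 - a * t 0) ^ m * f 0"
proof -
  have pos: "1 - x * t 0 > 0" and tx: "t x * (1 - x * t 0) = t 0" if "x \<in> I" for x
    using ODE_square[OF I(1,2) that t] by auto
  have "inverse (1 - a * t 0) ^ m * f a = inverse (1 - 0 * t 0) ^ m * f 0"
  proof (rule ODE_product_constant[where k = "\<lambda>x. real m * t x", OF I])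
    fix x assume x: "x \<in> I"
    have "t x = t 0 * inverse (1 - x * t 0)"
      using pos[OF x] tx[OF x] by (simp add: field_simps)
    then have "((\<lambda>x. inverse (1 - x * t 0)) has_real_derivative
        t x * inverse (1 - x * t 0)) (at x within I)"
      using pos[OF x] by (auto intro!: derivative_eq_intros)
    from DERIV_power[OF this, of m]
    show "((\<lambda>x. inverse (1 - x * t 0) ^ m) has_real_derivative
        real m * t x * inverse (1 - x * t 0) ^ m) (at x within I)"
      \<comment> \<open>The power rule contains the truncated exponent \<open>m - 1\<close>, hence
        the separate case \<open>m = 0\<close>.\<close>
      by (cases m) (simp_all add: ac_simps)
    show "(f has_real_derivative - (real m * t x) * f x) (at x within I)"
      using has_field_derivative_at_within[OF f[OF x]] by simp
  qed
  then show ?thesis using pos[OF I(3)] by (simp add: field_simps)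
qed

text \<open>The equations are triangular: \<open>t\<close> is solved first, then \<open>r\<close>,
  for which \<open>r x * (1 - x * t 0)\<close> is constant, and finally the inhomogeneous equation
  for \<open>u\<close>.\<close>

lemma node_orbit_X_star:
  assumes I: "is_interval I" "0 \<in> I" "a \<in> I" and orb: "node_orbit (X_star n) I c"
  shows "a * tN (c 0) < 1 \<and> c a = proj_node a (c 0)"
proof -
  define t where "t x = tN (c x)" for x
  define u where "u x = uN (c x)" for x
  define r where "r x = rN (c x)" for x
  have d: "(t has_real_derivative (t x)\<^sup>2) (at x)"
    "(u has_real_derivative r x - t x * u x) (at x)"
    "(r has_real_derivative t x * r x) (at x)"
    "((\<lambda>x. sN (c x)) has_real_derivative 0) (at x)" if "x \<in> I" for x
    using orb that unfolding node_orbit_def X_star_def zero_gen_def t_def u_def r_def by simp_all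
  have pos: "1 - x * t 0 > 0" and tx: "t x * (1 - x * t 0) = t 0" if "x \<in> I" for x
    using ODE_square[OF I(1,2) that d(1)] by auto
  have rx: "r x * (1 - x * t 0) = r 0" if "x \<in> I" for x
  proof -
    have "r x * (1 - x * t 0) = r 0 * (1 - 0 * t 0)"
      by (rule ODE_product_constant[where k = t, OF I(1,2) that])
         (auto intro!: derivative_eq_intros has_field_derivative_at_within[OF d(3)] simp: tx)
    then show ?thesis by simp
  qed
  \<comment> \<open>The difference between \<open>u\<close> and the explicit solution solves the
    homogeneous equation \<open>w' = - t * w\<close> with initial value \<open>0\<close>, which is
    the case \<open>m = 1\<close>.\<close>
  have "u a - ((1 - a * t 0) * u 0 + a * r 0) = (1 - a * t 0) ^ 1 * (u 0 - ((1 - 0 * t 0) * u 0 + 0 * r 0))"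
  proof (rule ODE_along_square[where f = "\<lambda>x. u x - ((1 - x * t 0) * u 0 + x * r 0)", OF I d(1)])
    fix x assume x: "x \<in> I"
    \<comment> \<open>This equality, checked after multiplication by the positive
      \<open>1 - x * t 0\<close>, removes the inhomogeneous terms.\<close>
    have "r x - r 0 = t x * x * r 0"
    proof -
      have "(r x - r 0 - t x * x * r 0) * (1 - x * t 0) =
        r x * (1 - x * t 0) - r 0 * (1 - x * t 0) - x * r 0 * (t x * (1 - x * t 0))"
        by (simp add: algebra_simps)
      also have "\<dots> = 0" unfolding rx[OF x] tx[OF x] by (simp add: algebra_simps)
      finally show ?thesis using pos[OF x] by simp
    qed
    moreover have "t x * ((1 - x * t 0) * u 0) = t 0 * u 0"
      using tx[OF x] by (simp add: mult.assoc[symmetric])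
    ultimately have "r x - t x * u x - (- t 0 * u 0 + r 0) =
        - real 1 * t x * (u x - ((1 - x * t 0) * u 0 + x * r 0))"
      by (simp add: algebra_simps)
    then show "((\<lambda>x. u x - ((1 - x * t 0) * u 0 + x * r 0)) has_real_derivative
        - real 1 * t x * (u x - ((1 - x * t 0) * u 0 + x * r 0))) (at x)"
      by (auto intro!: derivative_eq_intros d(2)[OF x])
  qed
  then have ua: "u a = (1 - a * t 0) * u 0 + a * r 0" by simp
  have ta: "t a = t 0 / (1 - a * t 0)" and ra: "r a = r 0 / (1 - a * t 0)"
    using tx[OF I(3)] rx[OF I(3)] pos[OF I(3)] by (auto simp: eq_divide_eq)
  have "sN (c a) = sN (c 0)" using ODE_linear[OF I d(4)] by simp
  then show ?thesis
    using pos[OF I(3)] ta ra ua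
    by (auto simp: proj_node_def t_def u_def r_def intro!: node.equality)
qed

lemma cell_orbit_X_star:
  assumes I: "is_interval I" "0 \<in> I" "a \<in> I" and orb: "cell_orbit (X_star n) I c"
  shows "a * tC (c 0) < 1 \<and> c a = proj_cell n a (c 0)"
proof -
  have t: "((\<lambda>x. tC (c x)) has_real_derivative (tC (c x))\<^sup>2) (at x)"
    and s: "((\<lambda>x. sC (c x)) has_real_derivative 0) (at x)"
    and \<rho>: "((\<lambda>x. rhoC (c x)) has_real_derivative - real (n + 1) * tC (c x) * rhoC (c x)) (at x)"
    and p: "((\<lambda>x. pC (c x)) has_real_derivative - real (n + 3) * tC (c x) * pC (c x)) (at x)"
    if "x \<in> I" for x
    using orb that unfolding cell_orbit_def X_star_def zero_gen_def by (simp_all add: add.commute)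
  have "1 - a * tC (c 0) > 0" "tC (c a) = tC (c 0) / (1 - a * tC (c 0))"
    using ODE_square[OF I, of "\<lambda>x. tC (c x)"] t by (auto simp: eq_divide_eq)
  then show ?thesis
    using ODE_linear[OF I s] ODE_along_square[OF I t \<rho>] ODE_along_square[OF I t p]
    by (auto simp: proj_cell_def intro!: cell.equality)
qed

section \<open>Existence of the projective orbits, and invariance\<close>

lemma node_orbit_proj: "node_orbit (X_star n) {a. a * tN x < 1} (\<lambda>a. proj_node a x)"
  unfolding node_orbit_def
proof (intro ballI)
  fix a assume "a \<in> {a. a * tN x < 1}"
  then have "1 - a * tN x > 0" by simp
  \<comment> \<open>\<open>r - t * u\<close> is constant along the flow; this constant is the slope
    of the \<open>uN\<close> component, which is affine in \<open>a\<close>.\<close>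
  moreover have "rN x / q - tN x / q * (q * uN x + a * rN x) = rN x - tN x * uN x"
    if "q = 1 - a * tN x" "q > 0" for q
  proof -
    have "rN x / q - tN x / q * (q * uN x + a * rN x) = rN x * (1 - a * tN x) / q - tN x * uN x"
      using that(2) by (simp add: field_simps)
    then show ?thesis using that by simp
  qed
  ultimately show "((\<lambda>a. tN (proj_node a x)) has_real_derivative
       xi_t (X_star n) (tN (proj_node a x)) (sN (proj_node a x))) (at a) \<and>
     ((\<lambda>a. sN (proj_node a x)) has_real_derivative
       xi_s (X_star n) (tN (proj_node a x)) (sN (proj_node a x))) (at a) \<and>
     ((\<lambda>a. uN (proj_node a x)) has_real_derivative
       eta_u (X_star n) (tN (proj_node a x)) (sN (proj_node a x))
         (uN (proj_node a x)) (rN (proj_node a x))) (at a) \<and>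
     ((\<lambda>a. rN (proj_node a x)) has_real_derivative
       eta_r (X_star n) (tN (proj_node a x)) (sN (proj_node a x))
         (uN (proj_node a x)) (rN (proj_node a x))) (at a)"
    by (auto simp: proj_node_def X_star_def zero_gen_def power2_eq_square
        intro!: derivative_eq_intros)
qed

lemma cell_orbit_proj: "cell_orbit (X_star n) {a. a * tC y < 1} (\<lambda>a. proj_cell n a y)"
  unfolding cell_orbit_def
proof (intro ballI)
  fix a assume "a \<in> {a. a * tC y < 1}"
  then have q: "1 - a * tC y > 0" by simp
  have time: "((\<lambda>a. tC y / (1 - a * tC y)) has_real_derivative (tC y / (1 - a * tC y))\<^sup>2) (at a)"
    using q by (auto intro!: derivative_eq_intros simp: power2_eq_square)
  \<comment> \<open>Used for density and pressure; \<open>k\<close> is kept apart from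
    \<open>real m\<close> to match the coefficients as the generator writes them.\<close>
  have pow: "((\<lambda>a. (1 - a * tC y) ^ m * b) has_real_derivative
      - k * (tC y / (1 - a * tC y)) * ((1 - a * tC y) ^ m * b)) (at a)" if "k = real m" for k m b
  proof -
    have "((\<lambda>a. 1 - a * tC y) has_real_derivative - tC y) (at a)"
      by (auto intro!: derivative_eq_intros)
    note DERIV_cmult_right[OF DERIV_power[OF this, of m], of b]
    moreover have "real m * (- t * x ^ (m - Suc 0)) * b = - k * (t / x) * (x ^ m * b)"
      if "x > 0" for t x :: real
      using that \<open>k = real m\<close> by (cases m) (simp_all add: field_simps)
    ultimately show ?thesis using q by simp
  qed
  show "((\<lambda>a. tC (proj_cell n a y)) has_real_derivative
       xi_t (X_star n) (tC (proj_cell n a y)) (sC (proj_cell n a y))) (at a) \<and>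
     ((\<lambda>a. sC (proj_cell n a y)) has_real_derivative
       xi_s (X_star n) (tC (proj_cell n a y)) (sC (proj_cell n a y))) (at a) \<and>
     ((\<lambda>a. rhoC (proj_cell n a y)) has_real_derivative
       eta_rho (X_star n) (tC (proj_cell n a y)) (sC (proj_cell n a y))
         (rhoC (proj_cell n a y)) (pC (proj_cell n a y))) (at a) \<and>
     ((\<lambda>a. pC (proj_cell n a y)) has_real_derivative
       eta_p (X_star n) (tC (proj_cell n a y)) (sC (proj_cell n a y))
         (rhoC (proj_cell n a y)) (pC (proj_cell n a y))) (at a)"
    using time pow[of "real n + 1" "n + 1" "rhoC y"] pow[of "real n + 3" "n + 3" "pC y"]
    by (simp add: proj_cell_def X_star_def zero_gen_def del: power_Suc)
qed

text \<open>The parameter set \<open>a * t < 1\<close> is the side of the pole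
  \<open>a = 1 / t\<close> that contains \<open>0\<close>, and the whole line when
  \<open>t = 0\<close>.\<close>

lemma invariant_X_star: "invariant_under (X_star n) (scheme n)"
proof (rule invariant_underI[where D = "\<lambda>t. {a. a * t < 1}" and F = proj_node and G = "proj_cell n"])
  fix t :: real
  show "open {a. a * t < 1}" by (intro open_Collect_less continuous_intros)
  have "convex {a. inner t a < 1}" by (rule convex_halfspace_lt)
  then show "is_interval {a. a * t < 1}" by (simp add: is_interval_convex_1 mult.commute)
next
  fix z a assume "z \<in> scheme n" "a \<in> {a. a * tN (nd z) < 1}" "a \<in> {a. a * tN (nd_h z) < 1}"
  then show "map_stencil (proj_node a) (proj_cell n a) z \<in> scheme n"
    by (intro scheme_proj) simp_all
next
  fix I c and a :: real
  assume "node_orbit (X_star n) I c" "is_interval I" "0 \<in> I" "a \<in> I"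
  then show "a \<in> {a. a * tN (c 0) < 1} \<and> c a = proj_node a (c 0)"
    using node_orbit_X_star by blast
next
  fix I c and a :: real
  assume "cell_orbit (X_star n) I c" "is_interval I" "0 \<in> I" "a \<in> I"
  then show "a \<in> {a. a * tC (c 0) < 1} \<and> c a = proj_cell n a (c 0)"
    using cell_orbit_X_star by blast
qed (simp_all add: node_orbit_proj cell_orbit_proj, simp_all add: proj_node_def proj_cell_def)

subsection \<open>Conservation of mass\<close>

text \<open>The increment \<open>rh - r\<close> cancels against the velocity. If it is zero, both
  sides vanish, so the value of the quotient at equal arguments is harmless.\<close>

lemma R_coeff_velocity:
  assumes "(rh - r) / \<tau> = u"
  shows "R_coeff n r rh * u = (rh ^ (n + 1) - r ^ (n + 1)) / ((real n + 1) * \<tau>)"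
  using assms by (cases "rh = r") (auto simp: R_coeff_def)

text \<open>With cell volumes \<open>V\<close> and \<open>Vh\<close>, the mass equation states that
  \<open>rhoC (cl_h z) * Vh\<close> equals \<open>rhoC (cl z) * V\<close>, which is
  \<open>hs z\<close> by the normalization of the lower layer. The divergence form says the same in
  terms of specific volumes \<open>1 / \<rho>\<close>.\<close>

lemma mass_conservation:
  assumes mesh: "orthogonal_mesh z" and st: "positive_state z" and traj: "eq_trajectory z"
    and hs: "hs z = rhoC (cl z) * ((rN (nd_p z) ^ (n + 1) - rN (nd z) ^ (n + 1)) / (real n + 1))"
  shows "eq_mass n z \<longleftrightarrow>
      hs z = rhoC (cl_h z) * ((rN (nd_hp z) ^ (n + 1) - rN (nd_h z) ^ (n + 1)) / (real n + 1))"
    and "eq_mass n z \<longleftrightarrow> eq_mass_divergence n z"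
proof -
  \<comment> \<open>The integrals of \<open>r ^ n\<close> over the cell on the two layers.\<close>
  define V where "V = (rN (nd_p z) ^ (n + 1) - rN (nd z) ^ (n + 1)) / (real n + 1)"
  define Vh where "Vh = (rN (nd_hp z) ^ (n + 1) - rN (nd_h z) ^ (n + 1)) / (real n + 1)"
  have V: "rN (nd_p z) ^ (n + 1) - rN (nd z) ^ (n + 1) = (real n + 1) * V"
    and Vh: "rN (nd_hp z) ^ (n + 1) - rN (nd_h z) ^ (n + 1) = (real n + 1) * Vh"
    by (simp_all add: V_def Vh_def)
  have pos: "tau z > 0" "hs z > 0" "rhoC (cl z) > 0" "rhoC (cl_h z) > 0"
    using mesh st by (auto simp: orthogonal_mesh_def positive_state_def)
  have hsV: "hs z = rhoC (cl z) * V" using hs by (simp add: V_def)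
  have "eq_mass n z \<longleftrightarrow> (real n + 1) * (rhoC (cl_h z) * Vh) = (real n + 1) * (rhoC (cl z) * V)"
    unfolding eq_mass_def V Vh by (simp only: mult.left_commute)
  then have mass: "eq_mass n z \<longleftrightarrow> hs z = rhoC (cl_h z) * Vh"
    unfolding hsV by (auto simp del: mult_cancel_left simp: mult_left_cancel)
  then show "eq_mass n z \<longleftrightarrow>
      hs z = rhoC (cl_h z) * ((rN (nd_hp z) ^ (n + 1) - rN (nd_h z) ^ (n + 1)) / (real n + 1))"
    by (simp add: Vh_def)
  have "R_coeff n (rN (nd_p z)) (rN (nd_hp z)) * uN (nd_p z)
      - R_coeff n (rN (nd z)) (rN (nd_h z)) * uN (nd z) =
      ((rN (nd_hp z) ^ (n + 1) - rN (nd_h z) ^ (n + 1))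
      - (rN (nd_p z) ^ (n + 1) - rN (nd z) ^ (n + 1))) / ((real n + 1) * tau z)"
  proof -
    have "(rN (nd_h z) - rN (nd z)) / tau z = uN (nd z)"
      "(rN (nd_hp z) - rN (nd_p z)) / tau z = uN (nd_p z)"
      using traj by (simp_all add: eq_trajectory_def)
    note R = this[THEN R_coeff_velocity]
    show ?thesis
      \<comment> \<open>The difference of the fluxes through the two nodes is regrouped into the
        difference between the two layers.\<close>
      unfolding R by (simp only: diff_divide_distrib[symmetric]) (simp only: algebra_simps)
  qed
  also have "\<dots> = 1 / tau z * (Vh - V)"
    unfolding V Vh right_diff_distrib[symmetric] by simp
  finally have "eq_mass_divergence n z \<longleftrightarrow>
      1 / tau z * (1 / rhoC (cl_h z) - 1 / rhoC (cl z)) = 1 / tau z * ((Vh - V) / hs z)"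
    unfolding eq_mass_divergence_def by simp
  also have "\<dots> \<longleftrightarrow> 1 / rhoC (cl_h z) - 1 / rhoC (cl z) = (Vh - V) / hs z"
    unfolding mult_cancel_left using pos by simp
  \<comment> \<open>The normalization lets the lower layer drop out on both sides, leaving the
    corresponding relation for the upper layer.\<close>
  also have "V / hs z = 1 / rhoC (cl z)"
    using hsV pos by (auto simp: field_simps)
  then have "(1 / rhoC (cl_h z) - 1 / rhoC (cl z) = (Vh - V) / hs z) \<longleftrightarrow> 1 / rhoC (cl_h z) = Vh / hs z"
    by (simp add: diff_divide_distrib)
  also have "\<dots> \<longleftrightarrow> hs z = rhoC (cl_h z) * Vh"
    using pos by (auto simp: field_simps)
  finally show "eq_mass n z \<longleftrightarrow> eq_mass_divergence n z" using mass by simp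
qed

theorem mainTheorem7:
  fixes n :: nat and \<gamma> :: real
  assumes "n \<in> {1, 2}" and "\<gamma> = (real n + 3) / (real n + 1)"
  shows "(\<forall>X \<in> {X0, X1, X2 n, X3 n, X4, X_star n}. invariant_under X (scheme n)) \<and>
    (\<forall>z \<in> scheme n.
       pC (cl_h z) / rhoC (cl_h z) powr \<gamma> = pC (cl z) / rhoC (cl z) powr \<gamma>) \<and>
    (\<forall>z. orthogonal_mesh z \<and> positive_state z \<and> eq_trajectory z \<and>
       hs z = rhoC (cl z) * ((rN (nd_p z) ^ (n + 1) - rN (nd z) ^ (n + 1)) / (real n + 1)) \<longrightarrow>
         (eq_mass n z \<longrightarrow>
            hs z = rhoC (cl_h z) * ((rN (nd_hp z) ^ (n + 1) - rN (nd_h z) ^ (n + 1)) / (real n + 1))) \<and>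
         (eq_mass n z \<longleftrightarrow> eq_mass_divergence n z))"
proof (intro conjI)
  \<comment> \<open>The weights are listed in the order \<open>t\<close>, \<open>s\<close>,
    \<open>u\<close>, \<open>r\<close>, \<open>\<rho>\<close>, \<open>p\<close>; each triple of
    generator, \<open>kr = kt + ku\<close> and \<open>ku + ks = kt + n * kr + kp\<close> is then
    plain arithmetic.\<close>
  have gens: "X0 = translation_gen 0 1" "X1 = translation_gen 1 0"
    "X2 n = scaling_gen 1 (real n + 1) 0 1 0 0" "X3 n = scaling_gen 2 (real n + 3) (- 1) 1 2 0"
    "X4 = scaling_gen 0 1 0 0 1 1"
    by (simp_all add: X0_def X1_def X2_def X3_def X4_def translation_gen_def scaling_gen_def
        zero_gen_def)
  show "\<forall>X \<in> {X0, X1, X2 n, X3 n, X4, X_star n}. invariant_under X (scheme n)"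
    unfolding gens by (simp add: invariant_translation invariant_scaling invariant_X_star)
  show "\<forall>z \<in> scheme n.
      pC (cl_h z) / rhoC (cl_h z) powr \<gamma> = pC (cl z) / rhoC (cl z) powr \<gamma>"
    by (simp add: assms(2) scheme_def eq_entropy_def)
qed (use mass_conservation in blast)

end
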